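(* Let $N\ge 2$ and consider $N$ agents with double-integrator dynamics subject to constant matched disturbances, $$\dot x_i = y_i,\qquad \dot y_i = u_i + d_i,\qquad x_i,y_i,u_i\in\mathbb{R},\ d_i\in\mathbb{R}\text{ constant},\ i\in\{1,\dots,N\},$$ interconnected through a weighted directed graph with weights $a_{ij}\ge 0$ ($a_{ii}=0$) whose Laplacian $L=[\ell_{ij}]\in\mathbb{R}^{N\times N}$, $\ell_{ii}=\sum_{k\in\mathcal N_i}a_{ik}$, $\ell_{ij}=-a_{ij}$ ($i\ne j$), is such that the graph contains a directed spanning tree. Apply the controller $$u_i = -\gamma_1\sum_{j=1}^{N} a_{ij}(x_i-x_j) - \gamma_2 y_i - \gamma_3\hat\delta_i,\qquad \dot{\hat\delta}_i = \gamma_1\sum_{j=1}^{N} a_{ij}(x_i-x_j) + \gamma_4 y_i,$$ with positive gains $\gamma_1,\gamma_2,\gamma_3,\gamma_4$, and set $\tilde\delta_i=\hat\delta_i-\frac{d_i}{\gamma_3}$, $x=(x_1,\dots,x_N)^\top$, $y=(y_1,\dots,y_N)^\top$, $\tilde\delta=(\tilde\delta_1,\dots,\tilde\delta_N)^\top$, so that the closed loop reads $\dot x=y$, $\dot y=-\gamma_1Lx-\gamma_2y-\gamma_3\tilde\delta$, $\dot{\tilde\delta}=\gamma_1Lx+\gamma_4y$. Define the consensus errors $$e_x=(I_N-\mathbf 1_N v_\ell^\top)x,\quad e_y=(I_N-\mathbf 1_N v_\ell^\top)y,\quad e_d=(I_N-\mathbf 1_N v_\ell^\top)\tilde\delta.$$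 Then the positive gains $\gamma_1,\dots,\gamma_4$ can be chosen such that, for all initial conditions, $(e_x(t),e_y(t),e_d(t))\to 0$ as $t\to\infty$ (equivalently, $x_i-v_\ell^\top x\to0$, $y_i-v_\ell^\top y\to 0$, $\tilde\delta_i-v_\ell^\top\tilde\delta\to0$ for all $i$). Moreover, this convergence is certified by a Lyapunov function $\mathcal H=\mathcal H_s+\mathcal H_d$ with $$\mathcal H_s=\tfrac12\begin{bmatrix}e_x\\ e_y\end{bmatrix}^\top\begin{bmatrix}\rho P&\epsilon P\\ \epsilon P& 2\mu I_N\end{bmatrix}\begin{bmatrix}e_x\\ e_y\end{bmatrix},\qquad \mathcal H_d=\tfrac12 b\begin{bmatrix}e_y\\ e_d\end{bmatrix}^\top\begin{bmatrix}2I_N& I_N\\ I_N& I_N\end{bmatrix}\begin{bmatrix}e_y\\ e_d\end{bmatrix},$$ for some scalars $\rho,\epsilon,\mu,b>0$ and symmetric positive definite $P\in\mathbb{R}^{N\times N}$ with $\sqrt{2\rho\mu/\|P\|}>\epsilon$ (so that $\mathcal H>0$).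
   Context: $\mathcal N_i$ is the set of indices of agents transmitting information to agent $i$; for a directed graph $L$ need not be symmetric. $\mathbf 1_N$ is the all-ones vector in $\mathbb{R}^N$, so $L\mathbf 1_N=0$. Under the spanning-tree assumption $0$ is a simple eigenvalue of $L$; $v_\ell\in\mathbb{R}^N$ denotes a left eigenvector of $L$ for the eigenvalue $0$ ($v_\ell^\top L=0$), normalized so that $v_\ell^\top\mathbf 1_N=1$. The quantities $v_\ell^\top x$, $v_\ell^\top y$, $v_\ell^\top\tilde\delta$ are called mean-field states. *)

theory Defs
  imports "HOL-Analysis.Analysis"
begin

text \<open>Agents are indexed by a finite type 'n (N = CARD('n)).
  Weight a i j is the weight of the edge from agent j to agent i
  (agent j transmits information to agent i iff a i j > 0).\<close>

definition ones :: "real^'n" where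
  "ones = (\<chi> i. 1)"

definition laplacian :: "('n::finite \<Rightarrow> 'n \<Rightarrow> real) \<Rightarrow> real^'n^'n" where
  "laplacian a = (\<chi> i j. if i = j then (\<Sum>k\<in>UNIV. a i k) else - a i j)"

text \<open>Directed edge j \<rightarrow> i iff a i j > 0.\<close>
definition graph_edges :: "('n \<Rightarrow> 'n \<Rightarrow> real) \<Rightarrow> ('n \<times> 'n) set" where
  "graph_edges a = {(j, i). a i j > 0}"

definition has_spanning_tree :: "('n \<Rightarrow> 'n \<Rightarrow> real) \<Rightarrow> bool" where
  "has_spanning_tree a \<longleftrightarrow> (\<exists>r. \<forall>i. (r, i) \<in> (graph_edges a)\<^sup>*)"

text \<open>Consensus error (I - 1 v^T) z.\<close>
definition cons_err :: "real^'n \<Rightarrow> real^'n::finite \<Rightarrow> real^'n" where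
  "cons_err v z = z - (v \<bullet> z) *\<^sub>R ones"

definition sym_pos_def :: "real^'n^'n::finite \<Rightarrow> bool" where
  "sym_pos_def P \<longleftrightarrow> transpose P = P \<and> (\<forall>z. z \<noteq> 0 \<longrightarrow> z \<bullet> (P *v z) > 0)"

definition H_s :: "real \<Rightarrow> real \<Rightarrow> real \<Rightarrow> real^'n^'n::finite \<Rightarrow> real^'n \<Rightarrow> real^'n \<Rightarrow> real" where
  "H_s \<rho> \<epsilon> \<mu> P ex ey =
     (1/2) * (\<rho> * (ex \<bullet> (P *v ex)) + \<epsilon> * (ex \<bullet> (P *v ey)) + \<epsilon> * (ey \<bullet> (P *v ex))
              + 2 * \<mu> * (ey \<bullet> ey))"

definition H_d :: "real \<Rightarrow> real^'n::finite \<Rightarrow> real^'n \<Rightarrow> real" where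
  "H_d b ey ed = (1/2) * b * (2 * (ey \<bullet> ey) + (ey \<bullet> ed) + (ed \<bullet> ey) + (ed \<bullet> ed))"

end

theory Submission
  imports Defs
begin

(*
  The core of the proof is a quadratic form that makes the Laplacian strictly positive on the
  disagreement subspace {z. v . z = 0}: a symmetric P >= I/2 with z . P L z >= c |z|^2 there.
  It comes from the lazy averaging map F = I - h L. Along a spanning tree the excess of any
  entry over the minimum reaches every node within K steps, so the spread max z - min z
  shrinks geometrically under F and some power F^N halves the norm on the subspace; the
  telescoping form z . P z = sum_{k<N} |F^k z|^2 then decreases by |z|^2/2 along F, and
  F = I - h L turns this into z . P L z >= |z|^2/(4h).

  With gains gamma1 = gamma3 = 1 and gamma2 = gamma4 = G, the projected closed loop reads
  e_x' = e_y, e_y' = - L e_x - G e_y - e_d, e_d' = L e_x + G e_y. For rho = epsilon G,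
  mu = b = 1, small epsilon and large G, Young's inequality gives H' <= - kappa H for
  H = H_s + H_d, so H, and with it every consensus error, decays exponentially.
*)

lemma laplacian_mult_vec_nth:
  assumes "\<And>i. a i i = 0"
  shows "(laplacian a *v z) $ i = (\<Sum>j\<in>UNIV. a i j * (z $ i - z $ j))"
proof -
  have "(laplacian a *v z) $ i
      = (\<Sum>j\<in>UNIV. (if i = j then (\<Sum>k\<in>UNIV. a i k) * z $ j else 0) - a i j * z $ j)"
    unfolding laplacian_def matrix_vector_mult_def
    by (auto intro!: sum.cong simp: assms)
  also have "\<dots> = (\<Sum>j\<in>UNIV. a i j * (z $ i - z $ j))"
    by (simp add: sum_subtractf sum_distrib_right right_diff_distrib)
  finally show ?thesis .
qed

lemma laplacian_mult_ones:
  assumes "\<And>i. a i i = 0"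
  shows "laplacian a *v ones = 0"
  by (simp add: vec_eq_iff laplacian_mult_vec_nth[OF assms] ones_def)

lemma inner_mult_vec_left_null:
  fixes L :: "real^'n^'m"
  assumes "v v* L = 0"
  shows "v \<bullet> (L *v z) = 0"
  by (metis assms dot_lmul_matrix inner_zero_left)

lemma linear_cons_err: "linear (cons_err v)"
  by (rule linearI) (simp_all add: cons_err_def algebra_simps inner_add_right)

lemma inner_cons_err:
  assumes "v \<bullet> ones = 1"
  shows "v \<bullet> cons_err v z = 0"
  using assms by (simp add: cons_err_def inner_diff_right)

lemma cons_err_eq_self: "v \<bullet> z = 0 \<Longrightarrow> cons_err v z = z"
  by (simp add: cons_err_def)

lemma cons_err_laplacian:
  assumes "\<And>i. a i i = 0" and "v v* laplacian a = 0"
  shows "cons_err v (laplacian a *v z) = laplacian a *v cons_err v z"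
  by (simp add: cons_err_def inner_mult_vec_left_null[OF assms(2)] laplacian_mult_ones[OF assms(1)]
      matrix_vector_mult_diff_distrib matrix_vector_mult_scaleR)

lemma has_vector_derivative_cons_err:
  assumes "(f has_vector_derivative f') F"
  shows "((\<lambda>t. cons_err v (f t)) has_vector_derivative cons_err v f') F"
  using bounded_linear.has_vector_derivative[OF
      linear_conv_bounded_linear[THEN iffD1, OF linear_cons_err] assms] .

section \<open>Contraction of the lazy consensus iteration\<close>

definition consensus_step :: "real^'n^'n::finite \<Rightarrow> real \<Rightarrow> real^'n \<Rightarrow> real^'n" where
  "consensus_step L h z = z - h *\<^sub>R (L *v z)"

lemma linear_consensus_step: "linear (consensus_step L h)"
  by (rule linearI)
    (simp_all add: consensus_step_def algebra_simps matrix_vector_right_distrib matrix_vector_mult_scaleR)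

lemma linear_consensus_iter: "linear (consensus_step L h ^^ k)"
  by (induction k)
    (simp_all add: linear_id[unfolded id_def] linear_compose[OF _ linear_consensus_step, unfolded o_def])

lemma inner_consensus_iter:
  assumes "v v* L = 0"
  shows "v \<bullet> (consensus_step L h ^^ k) z = v \<bullet> z"
  by (induction k) (simp_all add: consensus_step_def inner_diff_right inner_mult_vec_left_null[OF assms])

fun reachable_within :: "('n \<Rightarrow> 'n \<Rightarrow> real) \<Rightarrow> 'n \<Rightarrow> nat \<Rightarrow> 'n set" where
  "reachable_within a r 0 = {r}"
| "reachable_within a r (Suc k) = reachable_within a r k \<union> {i. \<exists>j\<in>reachable_within a r k. 0 < a i j}"

lemma reachable_within_mono: "k \<le> k' \<Longrightarrow> reachable_within a r k \<subseteq> reachable_within a r k'"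
  by (induction k' rule: dec_induct) auto

lemma reachable_within_of_rtrancl:
  assumes "(r, i) \<in> (graph_edges a)\<^sup>*"
  obtains k where "i \<in> reachable_within a r k"
  using assms
proof (induction arbitrary: thesis rule: rtrancl_induct)
  case base
  show ?case by (rule base(1)[of 0]) simp
next
  case (step j i)
  obtain k where "j \<in> reachable_within a r k" using step.IH by blast
  with step.hyps(2) have "i \<in> reachable_within a r (Suc k)" by (auto simp: graph_edges_def)
  then show ?case by (rule step.prems)
qed

lemma spanning_tree_reachable_within:
  fixes a :: "'n::finite \<Rightarrow> 'n \<Rightarrow> real"
  assumes "has_spanning_tree a"
  obtains K r where "0 < K" "\<And>i. i \<in> reachable_within a r K"
proof -
  obtain r where "\<And>i. (r, i) \<in> (graph_edges a)\<^sup>*"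
    using assms unfolding has_spanning_tree_def by blast
  then have "\<exists>k. i \<in> reachable_within a r k" for i
    using reachable_within_of_rtrancl by metis
  then obtain k where k: "\<And>i. i \<in> reachable_within a r (k i)"
    by metis
  define K where "K = Suc (Max (range k))"
  have "reachable_within a r (k i) \<subseteq> reachable_within a r K" for i
    by (rule reachable_within_mono) (simp add: K_def le_SucI)
  with k have "\<And>i. i \<in> reachable_within a r K" by blast
  then show ?thesis using that[of K r] by (simp add: K_def)
qed

lemma abs_nth_le_of_weighted_mean_zero:
  fixes v u :: "real^'n::finite"
  assumes v_sum: "v \<bullet> ones = 1" and mean: "v \<bullet> u = 0" and range: "\<And>j. m \<le> u $ j \<and> u $ j \<le> M"
  shows "\<bar>u $ i\<bar> \<le> (1 + (\<Sum>j\<in>UNIV. \<bar>v $ j\<bar>)) * (M - m)"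
proof -
  have "(\<Sum>j\<in>UNIV. v $ j * u $ j) = (\<Sum>j\<in>UNIV. v $ j * (u $ j - m) + m * v $ j)"
    by (simp add: algebra_simps)
  also have "\<dots> = (\<Sum>j\<in>UNIV. v $ j * (u $ j - m)) + m"
    using v_sum by (simp add: sum.distrib sum_distrib_left[symmetric] inner_vec_def ones_def)
  finally have m_eq: "m = - (\<Sum>j\<in>UNIV. v $ j * (u $ j - m))"
    using mean by (simp add: inner_vec_def)
  have "\<bar>\<Sum>j\<in>UNIV. v $ j * (u $ j - m)\<bar> \<le> (\<Sum>j\<in>UNIV. \<bar>v $ j\<bar> * (M - m))"
    using range by (intro order_trans[OF sum_abs] sum_mono) (auto simp: abs_mult intro!: mult_left_mono)
  then have "\<bar>m\<bar> \<le> (\<Sum>j\<in>UNIV. \<bar>v $ j\<bar>) * (M - m)"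
    by (subst m_eq) (simp add: sum_distrib_right)
  then show ?thesis
    using range[of i] by (simp add: algebra_simps abs_le_iff) linarith
qed

lemma inner_self_le_of_abs_nth_le:
  fixes u :: "real^'n::finite"
  assumes "\<And>i. \<bar>u $ i\<bar> \<le> B"
  shows "u \<bullet> u \<le> real CARD('n) * B\<^sup>2"
proof -
  have "u \<bullet> u = (\<Sum>i\<in>UNIV. (u $ i)\<^sup>2)" by (simp add: inner_vec_def power2_eq_square)
  also have "\<dots> \<le> (\<Sum>i\<in>(UNIV::'n set). B\<^sup>2)"
    by (rule sum_mono) (metis assms abs_ge_zero power2_abs power_mono)
  finally show ?thesis by simp
qed

context
  fixes a :: "'n::finite \<Rightarrow> 'n \<Rightarrow> real" and h \<alpha> :: real
  assumes a_diag: "\<And>i. a i i = 0" and a_nonneg: "\<And>i j. 0 \<le> a i j"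
    and h_pos: "0 < h" and h_lazy: "\<And>i. h * (\<Sum>j\<in>UNIV. a i j) \<le> 1/2"
    and \<alpha>_pos: "0 < \<alpha>" and \<alpha>_le_half: "\<alpha> \<le> 1/2"
    and \<alpha>_le_weight: "\<And>i j. 0 < a i j \<Longrightarrow> \<alpha> \<le> h * a i j"
begin

lemma consensus_step_nth_shift:
  "consensus_step (laplacian a) h z $ i - m
    = (1 - h * (\<Sum>j\<in>UNIV. a i j)) * (z $ i - m) + h * (\<Sum>j\<in>UNIV. a i j * (z $ j - m))"
proof -
  have "(\<Sum>j\<in>UNIV. a i j * (z $ i - z $ j))
      = (\<Sum>j\<in>UNIV. a i j * (z $ i - m) - a i j * (z $ j - m))"
    by (simp add: algebra_simps)
  also have "\<dots> = (\<Sum>j\<in>UNIV. a i j) * (z $ i - m) - (\<Sum>j\<in>UNIV. a i j * (z $ j - m))"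
    by (simp add: sum_subtractf sum_distrib_right)
  finally show ?thesis
    by (simp only: consensus_step_def vector_minus_component vector_scaleR_component
        laplacian_mult_vec_nth[OF a_diag]) (simp add: algebra_simps)
qed

lemma consensus_step_lower:
  assumes lower: "\<And>j. m \<le> z $ j"
  shows "m \<le> consensus_step (laplacian a) h z $ i"
    and "1/2 * (z $ i - m) \<le> consensus_step (laplacian a) h z $ i - m"
    and "h * a i j * (z $ j - m) \<le> consensus_step (laplacian a) h z $ i - m"
proof -
  note shift = consensus_step_nth_shift[of z i m]
  have self: "1/2 * (z $ i - m) \<le> (1 - h * (\<Sum>j\<in>UNIV. a i j)) * (z $ i - m)"
    using h_lazy[of i] lower[of i] by (intro mult_right_mono) auto
  have "a i j * (z $ j - m) \<le> (\<Sum>j\<in>UNIV. a i j * (z $ j - m))"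
    using a_nonneg lower by (intro member_le_sum) auto
  then have neighbour: "h * a i j * (z $ j - m) \<le> h * (\<Sum>j\<in>UNIV. a i j * (z $ j - m))"
    using h_pos by (simp add: mult.assoc)
  have "0 \<le> h * (\<Sum>j\<in>UNIV. a i j * (z $ j - m))"
    using h_pos a_nonneg lower by (intro mult_nonneg_nonneg sum_nonneg) auto
  moreover have "0 \<le> z $ i - m" using lower[of i] by simp
  moreover note self neighbour shift
  ultimately show "m \<le> consensus_step (laplacian a) h z $ i"
    and "1/2 * (z $ i - m) \<le> consensus_step (laplacian a) h z $ i - m"
    and "h * a i j * (z $ j - m) \<le> consensus_step (laplacian a) h z $ i - m"
    by argo+
qed

text \<open>Every step keeps weight at least \<open>1/2\<close> on the node itself and weight at least \<open>\<alpha>\<close>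
  on each in-neighbour, so the excess over a lower bound \<open>m\<close> spreads from the root along the
  edges, losing at most a factor \<open>\<alpha>\<close> per step.\<close>

lemma consensus_iter_lower:
  assumes lower: "\<And>j. m \<le> z $ j"
  shows "(\<forall>i. m \<le> (consensus_step (laplacian a) h ^^ k) z $ i) \<and>
    (\<forall>i\<in>reachable_within a r k. \<alpha> ^ k * (z $ r - m) \<le> (consensus_step (laplacian a) h ^^ k) z $ i - m)"
proof (induction k)
  case 0
  then show ?case using lower by simp
next
  case (Suc k)
  define w where "w = (consensus_step (laplacian a) h ^^ k) z"
  have w_lower: "\<And>j. m \<le> w $ j"
    and w_reach: "\<And>i. i \<in> reachable_within a r k \<Longrightarrow> \<alpha> ^ k * (z $ r - m) \<le> w $ i - m"
    using Suc.IH by (auto simp: w_def)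
  have root: "0 \<le> z $ r - m" using lower[of r] by simp
  have "m \<le> consensus_step (laplacian a) h w $ i" for i
    by (rule consensus_step_lower(1)[OF w_lower])
  moreover have "\<alpha> ^ Suc k * (z $ r - m) \<le> consensus_step (laplacian a) h w $ i - m"
    if "i \<in> reachable_within a r (Suc k)" for i
  proof -
    from that consider "i \<in> reachable_within a r k"
      | j where "j \<in> reachable_within a r k" "0 < a i j" by auto
    then show ?thesis
    proof cases
      case 1
      have "\<alpha> ^ Suc k * (z $ r - m) = \<alpha> * (\<alpha> ^ k * (z $ r - m))" by simp
      also have "\<dots> \<le> 1/2 * (w $ i - m)"
        using w_reach[OF 1] \<alpha>_pos \<alpha>_le_half root by (intro mult_mono) auto
      also have "\<dots> \<le> consensus_step (laplacian a) h w $ i - m"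
        by (rule consensus_step_lower(2)[OF w_lower])
      finally show ?thesis .
    next
      case (2 j)
      have "\<alpha> ^ Suc k * (z $ r - m) = \<alpha> * (\<alpha> ^ k * (z $ r - m))" by simp
      also have "\<dots> \<le> h * a i j * (w $ j - m)"
        using w_reach[OF 2(1)] \<alpha>_pos \<alpha>_le_weight[OF 2(2)] root by (intro mult_mono) auto
      also have "\<dots> \<le> consensus_step (laplacian a) h w $ i - m"
        by (rule consensus_step_lower(3)[OF w_lower])
      finally show ?thesis .
    qed
  qed
  ultimately show ?case by (simp add: w_def)
qed

lemma consensus_iter_range:
  assumes K: "\<And>i. i \<in> reachable_within a r K"
    and range: "\<And>j. m \<le> z $ j \<and> z $ j \<le> M"
  shows "m + \<alpha> ^ K * (z $ r - m) \<le> (consensus_step (laplacian a) h ^^ K) z $ i"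
    and "(consensus_step (laplacian a) h ^^ K) z $ i \<le> M - \<alpha> ^ K * (M - z $ r)"
proof -
  have "\<alpha> ^ K * (z $ r - m) \<le> (consensus_step (laplacian a) h ^^ K) z $ i - m"
    using consensus_iter_lower[of m z K r] range K by blast
  then show "m + \<alpha> ^ K * (z $ r - m) \<le> (consensus_step (laplacian a) h ^^ K) z $ i"
    by simp
  have "\<And>j. - M \<le> (- z) $ j" using range by simp
  then have "\<alpha> ^ K * ((- z) $ r - - M) \<le> (consensus_step (laplacian a) h ^^ K) (- z) $ i - - M"
    using consensus_iter_lower[of "- M" "- z" K r] K by blast
  then show "(consensus_step (laplacian a) h ^^ K) z $ i \<le> M - \<alpha> ^ K * (M - z $ r)"
    by (simp add: linear_neg[OF linear_consensus_iter])
qed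

lemma consensus_iter_spread:
  assumes K: "\<And>i. i \<in> reachable_within a r K"
    and range: "\<And>j. m \<le> z $ j \<and> z $ j \<le> M"
  shows "\<exists>m' M'. (\<forall>i. m' \<le> (consensus_step (laplacian a) h ^^ (K * n)) z $ i
      \<and> (consensus_step (laplacian a) h ^^ (K * n)) z $ i \<le> M')
    \<and> M' - m' = (1 - \<alpha> ^ K) ^ n * (M - m)"
proof (induction n)
  case 0
  show ?case using range by auto
next
  case (Suc n)
  define w where "w = (consensus_step (laplacian a) h ^^ (K * n)) z"
  obtain m' M' where range': "\<And>j. m' \<le> w $ j \<and> w $ j \<le> M'"
    and spread: "M' - m' = (1 - \<alpha> ^ K) ^ n * (M - m)"
    using Suc.IH unfolding w_def by blast
  have iter: "(consensus_step (laplacian a) h ^^ (K * Suc n)) z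
      = (consensus_step (laplacian a) h ^^ K) w"
    by (simp add: w_def funpow_add)
  have "(M' - \<alpha> ^ K * (M' - w $ r)) - (m' + \<alpha> ^ K * (w $ r - m'))
      = (1 - \<alpha> ^ K) ^ Suc n * (M - m)"
    by (simp only: power_Suc mult.assoc flip: spread) (simp add: algebra_simps)
  then show ?case
    using consensus_iter_range[OF K range'] unfolding iter by blast
qed

text \<open>On the subspace \<open>v \<bullet> z = 0\<close> the entries are bounded by their spread, which shrinks by
  the factor \<open>1 - \<alpha>^K\<close> every \<open>K\<close> steps.\<close>

lemma consensus_iter_norm_le:
  fixes v :: "real^'n"
  assumes K: "\<And>i. i \<in> reachable_within a r K"
    and v_left: "v v* laplacian a = 0" and v_sum: "v \<bullet> ones = 1" and "v \<bullet> z = 0"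
  shows "(consensus_step (laplacian a) h ^^ (K * n)) z \<bullet> (consensus_step (laplacian a) h ^^ (K * n)) z
    \<le> 4 * real CARD('n) * (1 + (\<Sum>j\<in>UNIV. \<bar>v $ j\<bar>))\<^sup>2 * ((1 - \<alpha> ^ K)\<^sup>2) ^ n * (z \<bullet> z)"
proof -
  define u where "u = (consensus_step (laplacian a) h ^^ (K * n)) z"
  define V where "V = (\<Sum>j\<in>UNIV. \<bar>v $ j\<bar>)"
  have "- norm z \<le> z $ j \<and> z $ j \<le> norm z" for j
    using component_le_norm_cart[of z j] by (auto simp: abs_le_iff)
  from consensus_iter_spread[OF K this, of n]
  obtain m M where range: "\<And>i. m \<le> u $ i \<and> u $ i \<le> M"
    and spread: "M - m = (1 - \<alpha> ^ K) ^ n * (norm z - - norm z)"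
    unfolding u_def by blast
  have "v \<bullet> u = 0" using \<open>v \<bullet> z = 0\<close> by (simp add: u_def inner_consensus_iter[OF v_left])
  then have "\<bar>u $ i\<bar> \<le> (1 + V) * ((1 - \<alpha> ^ K) ^ n * (2 * norm z))" for i
    using abs_nth_le_of_weighted_mean_zero[OF v_sum _ range] by (simp add: V_def spread)
  then have "u \<bullet> u \<le> real CARD('n) * ((1 + V) * ((1 - \<alpha> ^ K) ^ n * (2 * norm z)))\<^sup>2"
    by (rule inner_self_le_of_abs_nth_le)
  also have "\<dots> = 4 * real CARD('n) * (1 + V)\<^sup>2 * ((1 - \<alpha> ^ K) ^ n)\<^sup>2 * (norm z)\<^sup>2"
    by (simp add: power_mult_distrib mult_ac)
  also have "\<dots> = 4 * real CARD('n) * (1 + V)\<^sup>2 * ((1 - \<alpha> ^ K)\<^sup>2) ^ n * (z \<bullet> z)"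
    by (simp only: power2_norm_eq_inner power_mult[symmetric] mult.commute)
  finally show ?thesis by (simp add: u_def V_def)
qed

lemma consensus_iter_contracts:
  fixes v :: "real^'n"
  assumes K: "0 < K" "\<And>i. i \<in> reachable_within a r K"
    and v_left: "v v* laplacian a = 0" and v_sum: "v \<bullet> ones = 1"
  obtains N where "0 < N"
    "\<And>z. v \<bullet> z = 0 \<Longrightarrow>
      (consensus_step (laplacian a) h ^^ N) z \<bullet> (consensus_step (laplacian a) h ^^ N) z \<le> 1/2 * (z \<bullet> z)"
proof -
  define C where "C = 4 * real CARD('n) * (1 + (\<Sum>j\<in>UNIV. \<bar>v $ j\<bar>))\<^sup>2"
  have "1 \<le> (1 + (\<Sum>j\<in>UNIV. \<bar>v $ j\<bar>))\<^sup>2" by (simp add: sum_nonneg)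
  moreover have "1 \<le> real CARD('n)" by (simp add: Suc_le_eq)
  ultimately have C: "4 \<le> C"
    using mult_mono[of 1 "real CARD('n)" 1 "(1 + (\<Sum>j\<in>UNIV. \<bar>v $ j\<bar>))\<^sup>2"] by (simp add: C_def)
  have "0 < \<alpha> ^ K" "\<alpha> ^ K \<le> 1" using \<alpha>_pos \<alpha>_le_half by (auto simp: power_le_one)
  then have "(1 - \<alpha> ^ K)\<^sup>2 < 1" by (simp add: abs_square_less_1)
  then obtain n where n: "((1 - \<alpha> ^ K)\<^sup>2) ^ n < 1 / (2 * C)"
    using real_arch_pow_inv[of "1 / (2 * C)"] C by auto
  have "n \<noteq> 0"
  proof
    assume "n = 0"
    with n C show False by (simp add: field_simps)
  qed
  have "(consensus_step (laplacian a) h ^^ (K * n)) z \<bullet> (consensus_step (laplacian a) h ^^ (K * n)) z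
      \<le> 1/2 * (z \<bullet> z)" if "v \<bullet> z = 0" for z
  proof -
    have "(consensus_step (laplacian a) h ^^ (K * n)) z \<bullet> (consensus_step (laplacian a) h ^^ (K * n)) z
        \<le> C * ((1 - \<alpha> ^ K)\<^sup>2) ^ n * (z \<bullet> z)"
      using consensus_iter_norm_le[OF K(2) v_left v_sum that, of n] by (simp only: C_def)
    also have "\<dots> \<le> C * (1 / (2 * C)) * (z \<bullet> z)"
      using less_imp_le[OF n] C by (intro mult_right_mono mult_left_mono) simp_all
    also have "\<dots> = 1/2 * (z \<bullet> z)" using C by simp
    finally show ?thesis .
  qed
  then show ?thesis using that[of "K * n"] K(1) \<open>n \<noteq> 0\<close> by simp
qed

end

lemma laplacian_consensus_contracts:
  fixes a :: "'n::finite \<Rightarrow> 'n \<Rightarrow> real" and v :: "real^'n"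
  assumes a_diag: "\<And>i. a i i = 0" and a_nonneg: "\<And>i j. 0 \<le> a i j"
    and tree: "has_spanning_tree a" and v_left: "v v* laplacian a = 0" and v_sum: "v \<bullet> ones = 1"
  obtains h N where "0 < h" "0 < N"
    "\<And>z. v \<bullet> z = 0 \<Longrightarrow>
      (consensus_step (laplacian a) h ^^ N) z \<bullet> (consensus_step (laplacian a) h ^^ N) z \<le> 1/2 * (z \<bullet> z)"
proof -
  obtain K r where K: "0 < K" "\<And>i. i \<in> reachable_within a r K"
    using tree by (rule spanning_tree_reachable_within) (rule that)
  define D where "D = 1 + (\<Sum>i\<in>UNIV. \<Sum>j\<in>UNIV. a i j)"
  have D: "1 \<le> D" using a_nonneg by (simp add: D_def sum_nonneg)
  define h where "h = 1 / (2 * D)"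
  have h_pos: "0 < h" using D by (simp add: h_def)
  have h_lazy: "h * (\<Sum>j\<in>UNIV. a i j) \<le> 1/2" for i
  proof -
    have "(\<Sum>j\<in>UNIV. a i j) \<le> (\<Sum>i\<in>UNIV. \<Sum>j\<in>UNIV. a i j)"
      using a_nonneg by (intro member_le_sum) (auto simp: sum_nonneg)
    then have "h * (\<Sum>j\<in>UNIV. a i j) \<le> h * D"
      using h_pos by (intro mult_left_mono) (simp_all add: D_def)
    also have "h * D = 1/2" using D by (simp add: h_def)
    finally show ?thesis .
  qed
  define a_min where "a_min = Min (insert 1 {a i j |i j. 0 < a i j})"
  have fin: "finite (insert 1 {a i j |i j. 0 < a i j})"
    by (rule finite.insertI, rule finite_subset[of _ "case_prod a ` UNIV"]) auto
  have a_min_pos: "0 < a_min"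
    unfolding a_min_def using fin by (subst Min_gr_iff) auto
  have a_min_le: "a_min \<le> a i j" if "0 < a i j" for i j
    unfolding a_min_def using fin by (rule Min_le) (use that in blast)
  define \<alpha> where "\<alpha> = min (1/2) (h * a_min)"
  have \<alpha>_pos: "0 < \<alpha>" and \<alpha>_le_half: "\<alpha> \<le> 1/2"
    using h_pos a_min_pos by (simp_all add: \<alpha>_def)
  have \<alpha>_le_weight: "\<alpha> \<le> h * a i j" if "0 < a i j" for i j
    using mult_left_mono[OF a_min_le[OF that], of h] h_pos unfolding \<alpha>_def by linarith
  show ?thesis
    by (rule consensus_iter_contracts[OF a_diag a_nonneg h_pos h_lazy \<alpha>_pos \<alpha>_le_half \<alpha>_le_weight
          K v_left v_sum])
      (auto intro: that[OF h_pos])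
qed

section \<open>A Lyapunov matrix for the Laplacian\<close>

lemma inner_ones_self: "ones \<bullet> (ones :: real^'n::finite) = real CARD('n)"
  by (simp add: ones_def inner_vec_def)

lemma inner_add_self_le: "(x + y) \<bullet> (x + y) \<le> 2 * (x \<bullet> x) + 2 * (y \<bullet> (y :: 'a::real_inner))"
  using inner_ge_zero[of "x - y"]
  by (simp add: inner_add_left inner_add_right inner_diff_left inner_diff_right inner_commute)

lemma inner_matrix_vector_sym:
  fixes P :: "real^'n^'n"
  assumes "transpose P = P"
  shows "x \<bullet> (P *v y) = y \<bullet> (P *v x)"
  by (metis assms dot_lmul_matrix inner_commute transpose_matrix_vector)

definition gram_matrix :: "('k \<Rightarrow> real^'n::finite \<Rightarrow> real^'m::finite) \<Rightarrow> 'k set \<Rightarrow> real^'n^'n" where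
  "gram_matrix f I = (\<Sum>k\<in>I. transpose (matrix (f k)) ** matrix (f k))"

lemma sum_matrix_vector_mult: "finite I \<Longrightarrow> (\<Sum>k\<in>I. M k) *v w = (\<Sum>k\<in>I. M k *v w)"
  by (induction I rule: finite_induct) (simp_all add: matrix_vector_mult_add_rdistrib)

lemma inner_gram_matrix:
  fixes f :: "'k \<Rightarrow> real^'n::finite \<Rightarrow> real^'m::finite"
  assumes "finite I" and "\<And>k. k \<in> I \<Longrightarrow> linear (f k)"
  shows "z \<bullet> (gram_matrix f I *v w) = (\<Sum>k\<in>I. f k z \<bullet> f k w)"
proof -
  have "z \<bullet> ((transpose A ** A) *v w) = (A *v z) \<bullet> (A *v w)" for A :: "real^'n^'m"
    by (metis dot_lmul_matrix inner_commute matrix_vector_mul_assoc transpose_matrix_vector)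
  then show ?thesis
    using assms by (simp add: gram_matrix_def sum_matrix_vector_mult inner_sum_right matrix_works)
qed

lemma transpose_sum: "transpose (\<Sum>k\<in>I. M k) = (\<Sum>k\<in>I. transpose (M k))"
  by (simp add: vec_eq_iff transpose_def sum_component)

lemma transpose_gram_matrix: "transpose (gram_matrix f I) = gram_matrix f I"
  by (simp add: gram_matrix_def transpose_sum matrix_transpose_mul)

text \<open>The rank one summand \<open>z \<mapsto> (v \<bullet> z) ones\<close> makes the form definite off the
  disagreement subspace \<open>v \<bullet> z = 0\<close>.\<close>

definition consensus_gram :: "real^'n^'n \<Rightarrow> real \<Rightarrow> real^'n \<Rightarrow> nat \<Rightarrow> real^'n^'n::finite" where
  "consensus_gram L h v N = gram_matrix
    (\<lambda>k. if k < N then (consensus_step L h ^^ k) \<circ> cons_err v else (\<lambda>z. (v \<bullet> z) *\<^sub>R ones)) {..<Suc N}"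

lemma inner_consensus_gram:
  fixes L :: "real^'n::finite^'n"
  shows "z \<bullet> (consensus_gram L h v N *v z)
    = (\<Sum>k<N. (consensus_step L h ^^ k) (cons_err v z) \<bullet> (consensus_step L h ^^ k) (cons_err v z))
      + real CARD('n) * (v \<bullet> z)\<^sup>2"
proof -
  have "linear (\<lambda>z. (v \<bullet> z) *\<^sub>R (ones :: real^'n))"
    by (rule linearI) (simp_all add: inner_add_right scaleR_add_left)
  moreover have "linear ((consensus_step L h ^^ k) \<circ> cons_err v)" for k
    by (rule linear_compose[OF linear_cons_err linear_consensus_iter])
  ultimately show ?thesis
    unfolding consensus_gram_def
    by (subst inner_gram_matrix) (simp_all add: inner_ones_self power2_eq_square)
qed

lemma inner_matrix_vector_lower_of_decrease:
  fixes P L :: "real^'n::finite^'n"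
  assumes P_sym: "transpose P = P" and P_nonneg: "\<And>w. 0 \<le> w \<bullet> (P *v w)" and "0 < h"
    and decrease: "consensus_step L h z \<bullet> (P *v consensus_step L h z) - z \<bullet> (P *v z) \<le> - 1/2 * (z \<bullet> z)"
  shows "1 / (4 * h) * (z \<bullet> z) \<le> z \<bullet> (P *v (L *v z))"
proof -
  have "consensus_step L h z \<bullet> (P *v consensus_step L h z) - z \<bullet> (P *v z)
      = - 2 * h * (z \<bullet> (P *v (L *v z))) + h\<^sup>2 * ((L *v z) \<bullet> (P *v (L *v z)))"
    using inner_matrix_vector_sym[OF P_sym, of "L *v z" z]
    by (simp add: consensus_step_def matrix_vector_mult_diff_distrib matrix_vector_mult_scaleR
        inner_diff_left inner_diff_right power2_eq_square algebra_simps)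
  moreover have "0 \<le> h\<^sup>2 * ((L *v z) \<bullet> (P *v (L *v z)))" using P_nonneg by simp
  ultimately have "1/2 * (z \<bullet> z) \<le> 2 * h * (z \<bullet> (P *v (L *v z)))"
    using decrease by linarith
  then show ?thesis using \<open>0 < h\<close> by (simp add: field_simps)
qed

text \<open>On the subspace \<open>v \<bullet> z = 0\<close> the form \<open>Q z = (\<Sum>k<N. |F^k z|\<^sup>2)\<close> of \<open>F = I - h L\<close>
  telescopes to \<open>Q (F z) - Q z = |F^N z|\<^sup>2 - |z|\<^sup>2 \<le> -|z|\<^sup>2/2\<close>, and expanding \<open>Q (F z)\<close> turns
  this into the bound on \<open>z \<bullet> P (L z)\<close>.\<close>

lemma lyapunov_matrix_of_contraction:
  fixes L :: "real^'n^'n::finite" and v :: "real^'n"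
  assumes v_left: "v v* L = 0" and v_sum: "v \<bullet> ones = 1" and h_pos: "0 < h" and N_pos: "0 < N"
    and contracts: "\<And>z. v \<bullet> z = 0 \<Longrightarrow>
      (consensus_step L h ^^ N) z \<bullet> (consensus_step L h ^^ N) z \<le> 1/2 * (z \<bullet> z)"
  obtains P where "transpose P = P" "\<And>z. 1/2 * (z \<bullet> z) \<le> z \<bullet> (P *v z)"
    "\<And>z. v \<bullet> z = 0 \<Longrightarrow> 1 / (4 * h) * (z \<bullet> z) \<le> z \<bullet> (P *v (L *v z))"
proof -
  define F where "F = consensus_step L h"
  define P where "P = consensus_gram L h v N"
  have P_sym: "transpose P = P" by (simp add: P_def consensus_gram_def transpose_gram_matrix)
  have P_inner: "z \<bullet> (P *v z) = (\<Sum>k<N. (F ^^ k) (cons_err v z) \<bullet> (F ^^ k) (cons_err v z))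
      + real CARD('n) * (v \<bullet> z)\<^sup>2" for z
    by (simp add: P_def F_def inner_consensus_gram)
  define Q where "Q z = (\<Sum>k<N. (F ^^ k) z \<bullet> (F ^^ k) z)" for z
  have P_Q: "z \<bullet> (P *v z) = Q z" if "v \<bullet> z = 0" for z
    using that by (simp add: P_inner Q_def cons_err_eq_self)
  have P_coercive: "1/2 * (z \<bullet> z) \<le> z \<bullet> (P *v z)" for z
  proof -
    define e where "e = cons_err v z"
    have "e \<bullet> e = (F ^^ 0) e \<bullet> (F ^^ 0) e" by simp
    also have "\<dots> \<le> (\<Sum>k<N. (F ^^ k) e \<bullet> (F ^^ k) e)"
      using N_pos by (intro member_le_sum) auto
    finally have "e \<bullet> e + real CARD('n) * (v \<bullet> z)\<^sup>2 \<le> z \<bullet> (P *v z)"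
      by (simp add: P_inner e_def)
    moreover have "z \<bullet> z \<le> 2 * (e \<bullet> e) + 2 * (((v \<bullet> z) *\<^sub>R ones) \<bullet> ((v \<bullet> z) *\<^sub>R (ones :: real^'n)))"
      using inner_add_self_le[of e "(v \<bullet> z) *\<^sub>R ones"] by (simp add: e_def cons_err_def)
    then have "z \<bullet> z \<le> 2 * (e \<bullet> e) + 2 * (real CARD('n) * (v \<bullet> z)\<^sup>2)"
      by (simp add: inner_ones_self power2_eq_square mult_ac)
    ultimately show ?thesis by linarith
  qed
  have "1 / (4 * h) * (z \<bullet> z) \<le> z \<bullet> (P *v (L *v z))" if z: "v \<bullet> z = 0" for z
  proof (rule inner_matrix_vector_lower_of_decrease[OF P_sym _ h_pos])
    show "0 \<le> w \<bullet> (P *v w)" for w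
      using P_coercive[of w] inner_ge_zero[of w] by linarith
    have "v \<bullet> F z = 0"
      using inner_consensus_iter[OF v_left, where h=h and k=1 and z=z] z by (simp add: F_def)
    then have "F z \<bullet> (P *v F z) - z \<bullet> (P *v z) = Q (F z) - Q z" by (simp add: P_Q z)
    also have "\<dots> = (F ^^ N) z \<bullet> (F ^^ N) z - z \<bullet> z"
      using sum_lessThan_telescope[of "\<lambda>k. (F ^^ k) z \<bullet> (F ^^ k) z" N]
      by (simp add: Q_def funpow_swap1 sum_subtractf)
    also have "\<dots> \<le> - 1/2 * (z \<bullet> z)" using contracts[OF z] by (simp add: F_def)
    finally show "consensus_step L h z \<bullet> (P *v consensus_step L h z) - z \<bullet> (P *v z) \<le> - 1/2 * (z \<bullet> z)"
      by (simp add: F_def)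
  qed
  with P_sym P_coercive show ?thesis by (rule that)
qed

lemma laplacian_lyapunov_matrix:
  fixes a :: "'n::finite \<Rightarrow> 'n \<Rightarrow> real" and v :: "real^'n"
  assumes a_diag: "\<And>i. a i i = 0" and a_nonneg: "\<And>i j. 0 \<le> a i j"
    and tree: "has_spanning_tree a" and v_left: "v v* laplacian a = 0" and v_sum: "v \<bullet> ones = 1"
  obtains P c where "transpose P = P" "\<And>z. 1/2 * (z \<bullet> z) \<le> z \<bullet> (P *v z)" "0 < c"
    "\<And>z. v \<bullet> z = 0 \<Longrightarrow> c * (z \<bullet> z) \<le> z \<bullet> (P *v (laplacian a *v z))"
proof -
  obtain h N where h: "0 < h" and "0 < N" and "\<And>z. v \<bullet> z = 0 \<Longrightarrow>
      (consensus_step (laplacian a) h ^^ N) z \<bullet> (consensus_step (laplacian a) h ^^ N) z \<le> 1/2 * (z \<bullet> z)"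
    by (rule laplacian_consensus_contracts[OF a_diag a_nonneg tree v_left v_sum]) (rule that)
  then obtain P where P: "transpose P = P" "\<And>z. 1/2 * (z \<bullet> z) \<le> z \<bullet> (P *v z)"
    "\<And>z. v \<bullet> z = 0 \<Longrightarrow> 1 / (4 * h) * (z \<bullet> z) \<le> z \<bullet> (P *v (laplacian a *v z))"
    by (rule lyapunov_matrix_of_contraction[OF v_left v_sum]) (auto intro: that)
  show ?thesis by (rule that[OF P(1,2) _ P(3)]) (use h in simp)
qed

section \<open>Exponential decay of the consensus errors\<close>

lemma abs_inner_matrix_vector_le:
  fixes M :: "real^'n::finite^'m::finite"
  shows "\<bar>x \<bullet> (M *v y)\<bar> \<le> onorm ((*v) M) * norm x * norm y"
proof -
  have "\<bar>x \<bullet> (M *v y)\<bar> \<le> norm x * norm (M *v y)" by (rule Cauchy_Schwarz_ineq2)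
  also have "\<dots> \<le> norm x * (onorm ((*v) M) * norm y)"
    by (intro mult_left_mono onorm) auto
  finally show ?thesis by (simp add: algebra_simps)
qed

lemma coercivity_le_bound:
  fixes P :: "real^'n::finite^'n"
  assumes "\<And>z. k * (z \<bullet> z) \<le> z \<bullet> (P *v z)" and "\<And>z. z \<bullet> (P *v z) \<le> p * (z \<bullet> z)"
  shows "k \<le> p"
  using order_trans[OF assms[of ones]] by (simp add: inner_ones_self)

lemma mult_le_weighted_squares:
  fixes x y s :: real
  assumes "0 < s"
  shows "x * y \<le> s / 4 * x\<^sup>2 + y\<^sup>2 / s"
proof -
  have "s * (s / 4 * x\<^sup>2 + y\<^sup>2 / s - x * y) = (s * x / 2 - y)\<^sup>2"
    using assms by (simp add: field_simps power2_eq_square)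
  then have "0 \<le> s * (s / 4 * x\<^sup>2 + y\<^sup>2 / s - x * y)" by simp
  with assms show ?thesis by (simp add: zero_le_mult_iff)
qed

lemma has_real_derivative_inner:
  fixes f g :: "real \<Rightarrow> 'a::real_inner"
  assumes "(f has_vector_derivative f') (at t within S)" and "(g has_vector_derivative g') (at t within S)"
  shows "((\<lambda>s. f s \<bullet> g s) has_real_derivative (f t \<bullet> g' + f' \<bullet> g t)) (at t within S)"
  using bounded_bilinear.has_vector_derivative[OF bounded_bilinear_inner assms]
  by (simp add: has_real_derivative_iff_has_vector_derivative)

lemma has_real_derivative_inner_matrix:
  fixes f g :: "real \<Rightarrow> real^'n::finite" and P :: "real^'n^'n"
  assumes "(f has_vector_derivative f') (at t within S)" and "(g has_vector_derivative g') (at t within S)"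
  shows "((\<lambda>s. f s \<bullet> (P *v g s)) has_real_derivative (f t \<bullet> (P *v g') + f' \<bullet> (P *v g t))) (at t within S)"
  using has_real_derivative_inner[OF assms(1)
      bounded_linear.has_vector_derivative[OF matrix_vector_mul_bounded_linear assms(2)]] .

lemma deriv_nonpos_imp_decreasing_nonneg:
  fixes f :: "real \<Rightarrow> real"
  assumes deriv: "\<And>t. 0 \<le> t \<Longrightarrow> (f has_real_derivative f' t) (at t within {0..})"
    and nonpos: "\<And>t. 0 \<le> t \<Longrightarrow> f' t \<le> 0" and "0 \<le> t1" "t1 \<le> t2"
  shows "f t2 \<le> f t1"
proof (rule DERIV_nonpos_imp_decreasing_open[OF \<open>t1 \<le> t2\<close>])
  fix t assume t: "t1 < t" "t < t2"
  then have "at t within {0..} = at t"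
    using \<open>0 \<le> t1\<close> by (intro at_within_open_subset[of t "{0<..}"]) auto
  then show "\<exists>y. (f has_real_derivative y) (at t) \<and> y \<le> 0"
    using deriv[of t] nonpos[of t] t \<open>0 \<le> t1\<close> by auto
next
  have "continuous_on {0..} f" by (rule DERIV_continuous_on) (use deriv in auto)
  then show "continuous_on {t1..t2} f" by (rule continuous_on_subset) (use \<open>0 \<le> t1\<close> in auto)
qed

lemma exp_decay_of_deriv_le:
  fixes f :: "real \<Rightarrow> real"
  assumes deriv: "\<And>t. 0 \<le> t \<Longrightarrow> (f has_real_derivative f' t) (at t within {0..})"
    and decay: "\<And>t. 0 \<le> t \<Longrightarrow> f' t \<le> - (k * f t)" and "0 \<le> t"
  shows "f t \<le> f 0 * exp (- (k * t))"
proof -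
  define g where "g s = exp (k * s) * f s" for s
  have "(g has_real_derivative exp (k * s) * (k * f s + f' s)) (at s within {0..})" if "0 \<le> s" for s
    unfolding g_def by (rule derivative_eq_intros deriv[OF that] refl | simp add: algebra_simps)+
  moreover have "exp (k * s) * (k * f s + f' s) \<le> 0" if "0 \<le> s" for s
    using decay[OF that] by (intro mult_nonneg_nonpos) auto
  ultimately have "g t \<le> g 0"
    by (rule deriv_nonpos_imp_decreasing_nonneg) (use \<open>0 \<le> t\<close> in auto)
  then show ?thesis by (simp add: g_def exp_minus field_simps)
qed

lemma tendsto_zero_of_exp_bound:
  fixes f :: "real \<Rightarrow> 'a::real_normed_vector"
  assumes bound: "\<And>t. 0 \<le> t \<Longrightarrow> C * (norm (f t))\<^sup>2 \<le> B * exp (- (k * t))" and "0 < C" "0 < k"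
  shows "(f \<longlongrightarrow> 0) at_top"
proof (rule Lim_null_comparison)
  show "\<forall>\<^sub>F t in at_top. norm (f t) \<le> sqrt (B / C * exp (- (k * t)))"
    using eventually_ge_at_top[of 0]
  proof eventually_elim
    case (elim t)
    then have "(norm (f t))\<^sup>2 \<le> B / C * exp (- (k * t))"
      using bound[of t] \<open>0 < C\<close> by (simp add: field_simps)
    then show ?case by (simp add: real_le_rsqrt)
  qed
  have "filterlim (\<lambda>t. k * t) at_top at_top"
    by (rule filterlim_tendsto_pos_mult_at_top[OF tendsto_const \<open>0 < k\<close> filterlim_ident])
  then have "filterlim (\<lambda>t. - (k * t)) at_bot at_top"
    by (simp add: filterlim_uminus_at_top)
  then have "((\<lambda>t. exp (- (k * t))) \<longlongrightarrow> 0) at_top"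
    by (rule filterlim_compose[OF exp_at_bot])
  from tendsto_real_sqrt[OF tendsto_mult_right_zero[OF this, of "B / C"]]
  show "((\<lambda>t. sqrt (B / C * exp (- (k * t)))) \<longlongrightarrow> 0) at_top" by simp
qed

text \<open>The Lyapunov function of the statement with \<open>\<rho> = e G\<close>, \<open>\<epsilon> = e\<close> and
  \<open>\<mu> = b = 1\<close>, along the projected closed loop with gains \<open>\<gamma>\<^sub>2 = \<gamma>\<^sub>4 = G\<close>. The constants
  \<open>p\<close> and \<open>l\<close> bound the bilinear forms of \<open>P\<close> and \<open>L\<close>; a small \<open>e\<close> keeps the cross term
  \<open>e x \<bullet> P y\<close> dominated, and a large \<open>G\<close> absorbs the cross terms of the derivative.\<close>

locale error_lyapunov =
  fixes L P :: "real^'n::finite^'n" and v :: "real^'n" and p l c e G :: real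
  assumes P_sym: "transpose P = P"
    and P_coercive: "\<And>z. 1/2 * (z \<bullet> z) \<le> z \<bullet> (P *v z)"
    and P_bound: "\<And>x y. \<bar>x \<bullet> (P *v y)\<bar> \<le> p * norm x * norm y"
    and L_bound: "\<And>x y. \<bar>x \<bullet> (L *v y)\<bar> \<le> l * norm x * norm y"
    and c_pos: "0 < c"
    and PL_coercive: "\<And>z. v \<bullet> z = 0 \<Longrightarrow> c * (z \<bullet> z) \<le> z \<bullet> (P *v (L *v z))"
    and e_pos: "0 < e" and e_small: "4 * e * p\<^sup>2 \<le> min c 1"
    and G_large: "e * p + 9 * l\<^sup>2 / (e * c) + 17 \<le> G"
begin

abbreviation lyap :: "real^'n \<Rightarrow> real^'n \<Rightarrow> real^'n \<Rightarrow> real" where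
  "lyap x y z \<equiv> H_s (e * G) e 1 P x y + H_d 1 y z"

abbreviation lyap_rate :: "real^'n \<Rightarrow> real^'n \<Rightarrow> real^'n \<Rightarrow> real" where
  "lyap_rate x y z \<equiv> e * (y \<bullet> (P *v y)) - e * (x \<bullet> (P *v (L *v x))) - e * (x \<bullet> (P *v z))
    - 3 * (y \<bullet> (L *v x)) - 3 * G * (norm y)\<^sup>2 - 4 * (y \<bullet> z) - (norm z)\<^sup>2"

lemma p_ge_half: "1/2 \<le> p"
proof (rule coercivity_le_bound[OF P_coercive])
  show "z \<bullet> (P *v z) \<le> p * (z \<bullet> z)" for z
    using P_bound[of z z] by (simp add: power2_norm_eq_inner[symmetric] power2_eq_square mult.assoc)
qed

lemma G_ge: "17 \<le> G"
proof -
  have "0 \<le> e * p + 9 * l\<^sup>2 / (e * c)"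
    using e_pos c_pos p_ge_half by (intro add_nonneg_nonneg) simp_all
  with G_large show ?thesis by linarith
qed

lemma sym_pos_def_P: "sym_pos_def P"
  unfolding sym_pos_def_def
proof (intro conjI P_sym allI impI)
  fix z :: "real^'n" assume "z \<noteq> 0"
  then have "0 < 1/2 * (z \<bullet> z)" by simp
  then show "0 < z \<bullet> (P *v z)" using P_coercive[of z] by linarith
qed

lemma gain_condition: "e < sqrt (2 * (e * G) * 1 / p)"
proof -
  have "0 \<le> 9 * l\<^sup>2 / (e * c)" using e_pos c_pos by simp
  then have "e * p < 2 * G" using G_large G_ge by linarith
  then have "e\<^sup>2 < 2 * (e * G) * 1 / p"
    using e_pos p_ge_half by (simp add: field_simps power2_eq_square)
  then show ?thesis using e_pos real_less_rsqrt by blast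
qed

lemma lyap_eq:
  "lyap x y z = 1/2 * (e * G * (x \<bullet> (P *v x))) + e * (x \<bullet> (P *v y)) + 2 * (norm y)\<^sup>2 + y \<bullet> z
    + 1/2 * (norm z)\<^sup>2"
  using inner_matrix_vector_sym[OF P_sym, of y x]
  by (simp add: H_s_def H_d_def inner_commute[of z y] power2_norm_eq_inner algebra_simps)

lemma lyap_lower: "e * G / 8 * (norm x)\<^sup>2 + 1/2 * (norm y)\<^sup>2 + 1/4 * (norm z)\<^sup>2 \<le> lyap x y z"
proof -
  have "1/2 * (e * G * (norm x)\<^sup>2) \<le> e * G * (x \<bullet> (P *v x))"
    using mult_left_mono[OF P_coercive[of x], of "e * G"] e_pos G_ge
    by (simp add: power2_norm_eq_inner algebra_simps)
  moreover have "- (e * p * (norm x * norm y)) \<le> e * (x \<bullet> (P *v y))"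
    using mult_left_mono[of "- (x \<bullet> (P *v y))" "p * norm x * norm y" e] P_bound[of x y] e_pos
    by (simp add: abs_le_iff algebra_simps)
  moreover have "e * p * (norm x * norm y) \<le> 1/2 * (e\<^sup>2 * p\<^sup>2 * (norm x)\<^sup>2) + 1/2 * (norm y)\<^sup>2"
    using mult_le_weighted_squares[of 2 "e * p * norm x" "norm y"] by (simp add: power_mult_distrib mult_ac)
  moreover have "e\<^sup>2 * p\<^sup>2 * (norm x)\<^sup>2 \<le> 1/4 * (e * G * (norm x)\<^sup>2)"
  proof -
    have "e * (4 * e * p\<^sup>2) \<le> e * G" using e_small G_ge e_pos by (intro mult_left_mono) auto
    from mult_right_mono[OF this, of "(norm x)\<^sup>2"] show ?thesis by (simp add: power2_eq_square algebra_simps)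
  qed
  moreover have "- (norm y * norm z) \<le> y \<bullet> z"
    using Cauchy_Schwarz_ineq2[of y z] by (simp add: abs_le_iff)
  moreover have "norm y * norm z \<le> (norm y)\<^sup>2 + 1/4 * (norm z)\<^sup>2"
    using mult_le_weighted_squares[of 4 "norm y" "norm z"] by simp
  ultimately have "1/8 * (e * G * (norm x)\<^sup>2) + 1/2 * (norm y)\<^sup>2 + 1/4 * (norm z)\<^sup>2 \<le> lyap x y z"
    unfolding lyap_eq by argo
  then show ?thesis by (simp add: algebra_simps)
qed

lemma lyap_upper: "lyap x y z \<le> (e * G * p + e * p + 3) * ((norm x)\<^sup>2 + (norm y)\<^sup>2 + (norm z)\<^sup>2)"
proof -
  have nonneg: "0 \<le> (norm w)\<^sup>2" "0 \<le> e * p * (norm w)\<^sup>2" "0 \<le> e * G * p * (norm w)\<^sup>2" for w :: "real^'n"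
    using e_pos G_ge p_ge_half by simp_all
  have "e * G * (x \<bullet> (P *v x)) \<le> e * G * p * (norm x)\<^sup>2"
    using mult_left_mono[of "x \<bullet> (P *v x)" "p * norm x * norm x" "e * G"] P_bound[of x x] e_pos G_ge
    by (simp add: abs_le_iff power2_eq_square mult_ac)
  moreover have "e * (x \<bullet> (P *v y)) \<le> e * p * (norm x * norm y)"
    using mult_left_mono[of "x \<bullet> (P *v y)" "p * norm x * norm y" e] P_bound[of x y] e_pos
    by (simp add: abs_le_iff mult_ac)
  moreover have "e * p * (norm x * norm y) \<le> 1/2 * (e * p * (norm x)\<^sup>2) + 1/2 * (e * p * (norm y)\<^sup>2)"
    using mult_left_mono[OF mult_le_weighted_squares[of 2 "norm x" "norm y"], of "e * p"] e_pos p_ge_half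
    by (simp add: algebra_simps)
  moreover have "y \<bullet> z \<le> 1/2 * (norm y)\<^sup>2 + 1/2 * (norm z)\<^sup>2"
    using Cauchy_Schwarz_ineq2[of y z] mult_le_weighted_squares[of 2 "norm y" "norm z"]
    by (simp add: abs_le_iff)
  moreover have "(e * G * p + e * p + 3) * ((norm x)\<^sup>2 + (norm y)\<^sup>2 + (norm z)\<^sup>2)
      = e * G * p * (norm x)\<^sup>2 + e * G * p * (norm y)\<^sup>2 + e * G * p * (norm z)\<^sup>2
        + e * p * (norm x)\<^sup>2 + e * p * (norm y)\<^sup>2 + e * p * (norm z)\<^sup>2
        + 3 * (norm x)\<^sup>2 + 3 * (norm y)\<^sup>2 + 3 * (norm z)\<^sup>2"
    by (simp add: algebra_simps)
  ultimately show ?thesis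
    using nonneg[of x] nonneg[of y] nonneg[of z] unfolding lyap_eq by argo
qed

lemma lyap_pos:
  assumes "(x, y, z) \<noteq> (0, 0, 0)"
  shows "0 < lyap x y z"
proof -
  have "0 < e * G / 8 * (norm x)\<^sup>2 + 1/2 * (norm y)\<^sup>2 + 1/4 * (norm z)\<^sup>2"
    using assms e_pos G_ge by (auto simp: add_pos_nonneg add_nonneg_pos)
  then show ?thesis by (rule less_le_trans[OF _ lyap_lower])
qed

lemma lyap_has_derivative:
  assumes "(x has_vector_derivative x') (at t within S)" "(y has_vector_derivative y') (at t within S)"
    "(z has_vector_derivative z') (at t within S)"
  shows "((\<lambda>s. lyap (x s) (y s) (z s)) has_real_derivative
    e * G * (x t \<bullet> (P *v x')) + e * (x t \<bullet> (P *v y') + x' \<bullet> (P *v y t)) + 4 * (y t \<bullet> y')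
    + y t \<bullet> z' + y' \<bullet> z t + z t \<bullet> z') (at t within S)"
proof -
  have "(\<lambda>s. lyap (x s) (y s) (z s)) = (\<lambda>s. 1/2 * (e * G * (x s \<bullet> (P *v x s))) + e * (x s \<bullet> (P *v y s))
      + 2 * (y s \<bullet> y s) + y s \<bullet> z s + 1/2 * (z s \<bullet> z s))"
    by (simp add: lyap_eq power2_norm_eq_inner)
  moreover have "((\<lambda>s. 1/2 * (e * G * (x s \<bullet> (P *v x s))) + e * (x s \<bullet> (P *v y s))
      + 2 * (y s \<bullet> y s) + y s \<bullet> z s + 1/2 * (z s \<bullet> z s)) has_real_derivative
      1/2 * (e * G * (x t \<bullet> (P *v x') + x' \<bullet> (P *v x t))) + e * (x t \<bullet> (P *v y') + x' \<bullet> (P *v y t))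
      + 2 * (y t \<bullet> y' + y' \<bullet> y t) + (y t \<bullet> z' + y' \<bullet> z t) + 1/2 * (z t \<bullet> z' + z' \<bullet> z t)) (at t within S)"
    by (intro DERIV_add DERIV_cmult has_real_derivative_inner_matrix has_real_derivative_inner assms)
  ultimately show ?thesis
    using inner_matrix_vector_sym[OF P_sym, of x' "x t"]
    by (simp add: inner_commute[of y'] inner_commute[of z'] algebra_simps)
qed

lemma lyap_has_derivative_closed_loop:
  assumes "(x has_vector_derivative y t) (at t within S)"
    "(y has_vector_derivative - (L *v x t) - G *\<^sub>R y t - z t) (at t within S)"
    "(z has_vector_derivative L *v x t + G *\<^sub>R y t) (at t within S)"
  shows "((\<lambda>s. lyap (x s) (y s) (z s)) has_real_derivative lyap_rate (x t) (y t) (z t)) (at t within S)"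
  using lyap_has_derivative[OF assms]
    inner_matrix_vector_sym[OF P_sym, of "y t" "x t"] inner_matrix_vector_sym[OF P_sym, of "z t" "x t"]
    inner_matrix_vector_sym[OF P_sym, of "L *v x t" "x t"]
  by (simp add: inner_add_left inner_add_right inner_diff_left inner_diff_right inner_minus_left
      matrix_vector_right_distrib matrix_vector_mult_diff_distrib matrix_vector_mult_scaleR
      linear_neg[OF matrix_vector_mul_linear] inner_commute[of "L *v x t"] inner_commute[of "z t" "y t"]
      power2_norm_eq_inner algebra_simps)

lemma lyap_rate_le:
  assumes "v \<bullet> x = 0"
  shows "lyap_rate x y z \<le> - (e * c / 2) * (norm x)\<^sup>2 - (norm y)\<^sup>2 - 1/2 * (norm z)\<^sup>2"
proof -
  have ec: "0 < e * c" using e_pos c_pos by simp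
  have "e * (y \<bullet> (P *v y)) \<le> e * p * (norm y)\<^sup>2"
    using mult_left_mono[of "y \<bullet> (P *v y)" "p * norm y * norm y" e] P_bound[of y y] e_pos
    by (simp add: abs_le_iff power2_eq_square mult_ac)
  moreover have "e * c * (norm x)\<^sup>2 \<le> e * (x \<bullet> (P *v (L *v x)))"
    using mult_left_mono[OF PL_coercive[OF assms], of e] e_pos
    by (simp add: power2_norm_eq_inner mult_ac)
  moreover have "- (e * (x \<bullet> (P *v z))) \<le> e * p * (norm x * norm z)"
    using mult_left_mono[of "- (x \<bullet> (P *v z))" "p * norm x * norm z" e] P_bound[of x z] e_pos
    by (simp add: abs_le_iff mult_ac)
  moreover have "e * p * (norm x * norm z) \<le> 1/4 * (e * c * (norm x)\<^sup>2) + e * p\<^sup>2 / c * (norm z)\<^sup>2"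
    using mult_le_weighted_squares[OF ec, of "norm x" "e * p * norm z"] c_pos e_pos
    by (simp add: power_mult_distrib power2_eq_square field_simps)
  moreover have "e * p\<^sup>2 / c * (norm z)\<^sup>2 \<le> 1/4 * (norm z)\<^sup>2"
    using e_small c_pos by (intro mult_right_mono) (simp_all add: field_simps)
  moreover have "- (y \<bullet> (L *v x)) \<le> l * (norm x * norm y)"
    using L_bound[of y x] by (simp add: abs_le_iff mult_ac)
  moreover have "3 * (l * (norm x * norm y)) \<le> 1/4 * (e * c * (norm x)\<^sup>2) + 9 * l\<^sup>2 / (e * c) * (norm y)\<^sup>2"
    using mult_le_weighted_squares[OF ec, of "norm x" "3 * l * norm y"] ec
    by (simp add: power_mult_distrib field_simps)
  moreover have "- (y \<bullet> z) \<le> norm y * norm z"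
    using Cauchy_Schwarz_ineq2[of y z] by (simp add: abs_le_iff)
  moreover have "4 * (norm y * norm z) \<le> 1/4 * (norm z)\<^sup>2 + 16 * (norm y)\<^sup>2"
    using mult_le_weighted_squares[of 1 "norm z" "4 * norm y"] by (simp add: power_mult_distrib mult_ac)
  moreover have "e * p * (norm y)\<^sup>2 + 9 * l\<^sup>2 / (e * c) * (norm y)\<^sup>2 + 17 * (norm y)\<^sup>2 \<le> G * (norm y)\<^sup>2"
    using mult_right_mono[OF G_large, of "(norm y)\<^sup>2"] by (simp add: algebra_simps)
  moreover have "0 \<le> G * (norm y)\<^sup>2" "3 * G * (norm y)\<^sup>2 = 3 * (G * (norm y)\<^sup>2)"
    using G_ge by simp_all
  ultimately have "lyap_rate x y z \<le> - 1/2 * (e * c * (norm x)\<^sup>2) - (norm y)\<^sup>2 - 1/2 * (norm z)\<^sup>2"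
    by argo
  then show ?thesis by (simp add: algebra_simps)
qed

lemma lyap_rate_le_lyap:
  assumes "v \<bullet> x = 0"
  shows "lyap_rate x y z \<le> - (min (e * c / 2) (1/2) / (e * G * p + e * p + 3) * lyap x y z)"
proof -
  define m where "m = min (e * c / 2) (1/2)"
  define M where "M = e * G * p + e * p + 3"
  define S where "S = (norm x)\<^sup>2 + (norm y)\<^sup>2 + (norm z)\<^sup>2"
  have "0 < m" "0 < M" using e_pos c_pos G_ge p_ge_half by (simp_all add: m_def M_def add_nonneg_pos)
  have "m * (norm x)\<^sup>2 \<le> e * c / 2 * (norm x)\<^sup>2" "m * (norm y)\<^sup>2 \<le> (norm y)\<^sup>2"
    "m * (norm z)\<^sup>2 \<le> 1/2 * (norm z)\<^sup>2"
    using mult_right_mono[of m "e * c / 2" "(norm x)\<^sup>2"] mult_right_mono[of m 1 "(norm y)\<^sup>2"]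
      mult_right_mono[of m "1/2" "(norm z)\<^sup>2"]
    by (simp_all add: m_def)
  moreover have "m * S = m * (norm x)\<^sup>2 + m * (norm y)\<^sup>2 + m * (norm z)\<^sup>2"
    by (simp add: S_def algebra_simps)
  ultimately have "lyap_rate x y z \<le> - (m * S)"
    using lyap_rate_le[OF assms, of y z] by argo
  moreover have "m / M * lyap x y z \<le> m / M * (M * S)"
    using lyap_upper[of x y z] \<open>0 < m\<close> \<open>0 < M\<close> by (intro mult_left_mono) (simp_all add: S_def M_def)
  ultimately show ?thesis using \<open>0 < M\<close> by (simp add: m_def M_def)
qed

lemma error_system_converges:
  fixes x y z :: "real \<Rightarrow> real^'n"
  assumes "\<And>t. 0 \<le> t \<Longrightarrow> (x has_vector_derivative y t) (at t within {0..})"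
    and "\<And>t. 0 \<le> t \<Longrightarrow> (y has_vector_derivative - (L *v x t) - G *\<^sub>R y t - z t) (at t within {0..})"
    and "\<And>t. 0 \<le> t \<Longrightarrow> (z has_vector_derivative L *v x t + G *\<^sub>R y t) (at t within {0..})"
    and orth: "\<And>t. v \<bullet> x t = 0"
  shows "(x \<longlongrightarrow> 0) at_top" "(y \<longlongrightarrow> 0) at_top" "(z \<longlongrightarrow> 0) at_top"
    and "\<And>t1 t2. 0 \<le> t1 \<Longrightarrow> t1 \<le> t2 \<Longrightarrow> lyap (x t2) (y t2) (z t2) \<le> lyap (x t1) (y t1) (z t1)"
proof -
  define V where "V t = lyap (x t) (y t) (z t)" for t
  define \<kappa> where "\<kappa> = min (e * c / 2) (1/2) / (e * G * p + e * p + 3)"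
  have \<kappa>: "0 < \<kappa>" using e_pos c_pos G_ge p_ge_half by (simp add: \<kappa>_def add_nonneg_pos)
  have deriv: "(V has_real_derivative lyap_rate (x t) (y t) (z t)) (at t within {0..})" if "0 \<le> t" for t
    unfolding V_def[abs_def] using assms(1-3)[OF that] by (rule lyap_has_derivative_closed_loop)
  have rate: "lyap_rate (x t) (y t) (z t) \<le> - (\<kappa> * V t)" for t
    unfolding V_def \<kappa>_def by (rule lyap_rate_le_lyap[OF orth])
  have V_lower: "e * G / 8 * (norm (x t))\<^sup>2 \<le> V t" "1/2 * (norm (y t))\<^sup>2 \<le> V t"
      "1/4 * (norm (z t))\<^sup>2 \<le> V t" "0 \<le> V t" for t
  proof -
    have "0 \<le> e * G / 8 * (norm (x t))\<^sup>2" using e_pos G_ge by simp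
    with lyap_lower[of "x t" "y t" "z t"] zero_le_power2[of "norm (y t)"] zero_le_power2[of "norm (z t)"]
    show "e * G / 8 * (norm (x t))\<^sup>2 \<le> V t" "1/2 * (norm (y t))\<^sup>2 \<le> V t"
      "1/4 * (norm (z t))\<^sup>2 \<le> V t" "0 \<le> V t"
      unfolding V_def by linarith+
  qed
  show "lyap (x t2) (y t2) (z t2) \<le> lyap (x t1) (y t1) (z t1)" if "0 \<le> t1" "t1 \<le> t2" for t1 t2
  proof -
    have "lyap_rate (x t) (y t) (z t) \<le> 0" for t
      using rate[of t] mult_nonneg_nonneg[OF less_imp_le[OF \<kappa>] V_lower(4)[of t]] by linarith
    with deriv have "V t2 \<le> V t1" by (rule deriv_nonpos_imp_decreasing_nonneg) (use that in auto)
    then show ?thesis by (simp add: V_def)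
  qed
  have converges: "(f \<longlongrightarrow> 0) at_top"
    if "0 < C" and bound: "\<And>t. C * (norm (f t))\<^sup>2 \<le> V t" for C and f :: "real \<Rightarrow> real^'n"
  proof (rule tendsto_zero_of_exp_bound)
    show "C * (norm (f t))\<^sup>2 \<le> V 0 * exp (- (\<kappa> * t))" if "0 \<le> t" for t
      by (rule order_trans[OF bound exp_decay_of_deriv_le[OF deriv rate that]])
  qed (use that \<kappa> in simp_all)
  have "0 < e * G / 8" using e_pos G_ge by simp
  then show "(x \<longlongrightarrow> 0) at_top" using V_lower(1) by (rule converges)
  show "(y \<longlongrightarrow> 0) at_top" using V_lower(2) by (rule converges[rotated]) simp
  show "(z \<longlongrightarrow> 0) at_top" using V_lower(3) by (rule converges[rotated]) simp
qed

end

lemma error_lyapunov_exists: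
  fixes L P :: "real^'n::finite^'n" and v :: "real^'n"
  assumes "transpose P = P" "\<And>z. 1/2 * (z \<bullet> z) \<le> z \<bullet> (P *v z)" "0 < c"
    "\<And>z. v \<bullet> z = 0 \<Longrightarrow> c * (z \<bullet> z) \<le> z \<bullet> (P *v (L *v z))"
  shows "\<exists>e G. error_lyapunov L P v (onorm ((*v) P)) (onorm ((*v) L)) c e G"
proof (intro exI)
  define p where "p = onorm ((*v) P)"
  define e where "e = min c 1 / (4 * p\<^sup>2 + 1)"
  have "4 * e * p\<^sup>2 = min c 1 * (4 * p\<^sup>2 / (4 * p\<^sup>2 + 1))" by (simp add: e_def)
  also have "\<dots> \<le> min c 1 * 1"
    using \<open>0 < c\<close> by (intro mult_left_mono) (simp_all add: divide_le_eq_1 add_nonneg_pos)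
  finally have "4 * e * p\<^sup>2 \<le> min c 1" by simp
  moreover have "0 < e" using \<open>0 < c\<close> by (simp add: e_def add_nonneg_pos)
  ultimately show "error_lyapunov L P v p (onorm ((*v) L)) c e
      (e * p + 9 * (onorm ((*v) L))\<^sup>2 / (e * c) + 17)"
    using assms by unfold_locales (simp_all add: p_def abs_inner_matrix_vector_le)
qed

section \<open>The controlled agents\<close>

text \<open>Shifting the estimate by \<open>d / \<gamma>\<^sub>3\<close> absorbs the constant disturbance, and the projection
  \<open>cons_err v\<close> commutes with the Laplacian because \<open>v\<close> is a left and \<open>ones\<close> a right null
  vector.\<close>

lemma consensus_error_dynamics:
  fixes a :: "'n::finite \<Rightarrow> 'n \<Rightarrow> real" and v d :: "real^'n" and x y \<delta>h :: "real \<Rightarrow> real^'n"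
  assumes a_diag: "\<And>i. a i i = 0" and v_left: "v v* laplacian a = 0" and "\<gamma>3 \<noteq> 0"
    and x': "(x has_vector_derivative y t) F"
    and y': "(y has_vector_derivative
      (\<chi> i. - \<gamma>1 * (\<Sum>j\<in>UNIV. a i j * (x t $ i - x t $ j)) - \<gamma>2 * (y t $ i) - \<gamma>3 * (\<delta>h t $ i) + d $ i)) F"
    and \<delta>': "(\<delta>h has_vector_derivative
      (\<chi> i. \<gamma>1 * (\<Sum>j\<in>UNIV. a i j * (x t $ i - x t $ j)) + \<gamma>4 * (y t $ i))) F"
  shows "((\<lambda>t. cons_err v (x t)) has_vector_derivative cons_err v (y t)) F"
    and "((\<lambda>t. cons_err v (y t)) has_vector_derivative
      - (\<gamma>1 *\<^sub>R (laplacian a *v cons_err v (x t))) - \<gamma>2 *\<^sub>R cons_err v (y t)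
      - \<gamma>3 *\<^sub>R cons_err v (\<delta>h t - (1 / \<gamma>3) *\<^sub>R d)) F"
    and "((\<lambda>t. cons_err v (\<delta>h t - (1 / \<gamma>3) *\<^sub>R d)) has_vector_derivative
      \<gamma>1 *\<^sub>R (laplacian a *v cons_err v (x t)) + \<gamma>4 *\<^sub>R cons_err v (y t)) F"
proof -
  let ?L = "laplacian a"
  have "(\<chi> i. - \<gamma>1 * (\<Sum>j\<in>UNIV. a i j * (x t $ i - x t $ j)) - \<gamma>2 * (y t $ i) - \<gamma>3 * (\<delta>h t $ i) + d $ i)
      = - (\<gamma>1 *\<^sub>R (?L *v x t)) - \<gamma>2 *\<^sub>R y t - \<gamma>3 *\<^sub>R (\<delta>h t - (1 / \<gamma>3) *\<^sub>R d)"
    using \<open>\<gamma>3 \<noteq> 0\<close> by (simp add: vec_eq_iff laplacian_mult_vec_nth[OF a_diag] algebra_simps)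
  with y' have y'': "(y has_vector_derivative
      - (\<gamma>1 *\<^sub>R (?L *v x t)) - \<gamma>2 *\<^sub>R y t - \<gamma>3 *\<^sub>R (\<delta>h t - (1 / \<gamma>3) *\<^sub>R d)) F"
    by simp
  have "(\<chi> i. \<gamma>1 * (\<Sum>j\<in>UNIV. a i j * (x t $ i - x t $ j)) + \<gamma>4 * (y t $ i))
      = \<gamma>1 *\<^sub>R (?L *v x t) + \<gamma>4 *\<^sub>R y t"
    by (simp add: vec_eq_iff laplacian_mult_vec_nth[OF a_diag])
  with \<delta>' have \<delta>'': "((\<lambda>t. \<delta>h t - (1 / \<gamma>3) *\<^sub>R d) has_vector_derivative \<gamma>1 *\<^sub>R (?L *v x t) + \<gamma>4 *\<^sub>R y t) F"
    by (simp add: has_vector_derivative_diff_const)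
  note cons_err_simps = linear_diff[OF linear_cons_err] linear_add[OF linear_cons_err]
    linear_neg[OF linear_cons_err] linear_cmul[OF linear_cons_err] cons_err_laplacian[OF a_diag v_left]
  show "((\<lambda>t. cons_err v (x t)) has_vector_derivative cons_err v (y t)) F"
    by (rule has_vector_derivative_cons_err[OF x'])
  show "((\<lambda>t. cons_err v (y t)) has_vector_derivative
      - (\<gamma>1 *\<^sub>R (?L *v cons_err v (x t))) - \<gamma>2 *\<^sub>R cons_err v (y t)
      - \<gamma>3 *\<^sub>R cons_err v (\<delta>h t - (1 / \<gamma>3) *\<^sub>R d)) F"
    using has_vector_derivative_cons_err[OF y'', of v] by (simp only: cons_err_simps)
  show "((\<lambda>t. cons_err v (\<delta>h t - (1 / \<gamma>3) *\<^sub>R d)) has_vector_derivative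
      \<gamma>1 *\<^sub>R (?L *v cons_err v (x t)) + \<gamma>4 *\<^sub>R cons_err v (y t)) F"
    using has_vector_derivative_cons_err[OF \<delta>'', of v] by (simp only: cons_err_simps)
qed

lemma consensus_controller_converges:
  fixes a :: "'n::finite \<Rightarrow> 'n \<Rightarrow> real" and v d :: "real^'n" and x y \<delta>h :: "real \<Rightarrow> real^'n"
  assumes "error_lyapunov (laplacian a) P v p l c e G"
    and a_diag: "\<And>i. a i i = 0" and v_left: "v v* laplacian a = 0" and v_sum: "v \<bullet> ones = 1"
    and gains: "\<gamma>1 = 1" "\<gamma>2 = G" "\<gamma>3 = 1" "\<gamma>4 = G"
    and ode: "\<forall>t\<ge>0. (x has_vector_derivative y t) (at t within {0..}) \<and>
      (y has_vector_derivative
        (\<chi> i. - \<gamma>1 * (\<Sum>j\<in>UNIV. a i j * (x t $ i - x t $ j)) - \<gamma>2 * (y t $ i) - \<gamma>3 * (\<delta>h t $ i) + d $ i))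
        (at t within {0..}) \<and>
      (\<delta>h has_vector_derivative (\<chi> i. \<gamma>1 * (\<Sum>j\<in>UNIV. a i j * (x t $ i - x t $ j)) + \<gamma>4 * (y t $ i)))
        (at t within {0..})"
  shows "let \<delta>t = (\<lambda>t. \<delta>h t - (1 / \<gamma>3) *\<^sub>R d);
      ex = (\<lambda>t. cons_err v (x t)); ey = (\<lambda>t. cons_err v (y t)); ed = (\<lambda>t. cons_err v (\<delta>t t))
    in (ex \<longlongrightarrow> 0) at_top \<and> (ey \<longlongrightarrow> 0) at_top \<and> (ed \<longlongrightarrow> 0) at_top \<and>
      (\<forall>t1 t2. 0 \<le> t1 \<and> t1 \<le> t2 \<longrightarrow>
        H_s (e * G) e 1 P (ex t2) (ey t2) + H_d 1 (ey t2) (ed t2)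
        \<le> H_s (e * G) e 1 P (ex t1) (ey t1) + H_d 1 (ey t1) (ed t1))"
proof -
  interpret error_lyapunov "laplacian a" P v p l c e G by fact
  define ex where "ex = (\<lambda>t. cons_err v (x t))"
  define ey where "ey = (\<lambda>t. cons_err v (y t))"
  define ed where "ed = (\<lambda>t. cons_err v (\<delta>h t - (1 / \<gamma>3) *\<^sub>R d))"
  have "(ex has_vector_derivative ey t) (at t within {0..})"
    "(ey has_vector_derivative - (laplacian a *v ex t) - G *\<^sub>R ey t - ed t) (at t within {0..})"
    "(ed has_vector_derivative laplacian a *v ex t + G *\<^sub>R ey t) (at t within {0..})" if "0 \<le> t" for t
    using consensus_error_dynamics[OF a_diag v_left _ conjunct1[OF ode[rule_format, OF that]]
        conjunct1[OF conjunct2[OF ode[rule_format, OF that]]]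
        conjunct2[OF conjunct2[OF ode[rule_format, OF that]]]]
    by (simp_all add: gains ex_def ey_def ed_def)
  moreover have "v \<bullet> ex t = 0" for t by (simp add: ex_def inner_cons_err[OF v_sum])
  ultimately show ?thesis
    using error_system_converges[of ex ey ed] unfolding Let_def ex_def ey_def ed_def by blast
qed

theorem proposition1:
  fixes a :: "'n::finite \<Rightarrow> 'n \<Rightarrow> real" and v :: "real^'n"
  assumes N2: "CARD('n) \<ge> 2"
    and a_nonneg: "\<And>i j. a i j \<ge> 0"
    and a_diag: "\<And>i. a i i = 0"
    and tree: "has_spanning_tree a"
    and v_left: "v v* laplacian a = 0"
    and v_norm: "v \<bullet> ones = 1"
  shows "\<exists>\<gamma>1 \<gamma>2 \<gamma>3 \<gamma>4 :: real. \<gamma>1 > 0 \<and> \<gamma>2 > 0 \<and> \<gamma>3 > 0 \<and> \<gamma>4 > 0 \<and>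
    (\<exists>\<rho> \<epsilon> \<mu> b :: real. \<exists>P :: real^'n^'n.
       \<rho> > 0 \<and> \<epsilon> > 0 \<and> \<mu> > 0 \<and> b > 0 \<and> sym_pos_def P \<and>
       sqrt (2 * \<rho> * \<mu> / onorm (\<lambda>z. P *v z)) > \<epsilon> \<and>
       (\<forall>ex ey ed :: real^'n. (ex, ey, ed) \<noteq> (0, 0, 0) \<longrightarrow>
          H_s \<rho> \<epsilon> \<mu> P ex ey + H_d b ey ed > 0) \<and>
       (\<forall>(d :: real^'n) (x :: real \<Rightarrow> real^'n) (y :: real \<Rightarrow> real^'n)
          (\<delta>h :: real \<Rightarrow> real^'n).
          (\<forall>t\<ge>0. (x has_vector_derivative y t) (at t within {0..}) \<and>
             (y has_vector_derivative
                (\<chi> i. - \<gamma>1 * (\<Sum>j\<in>UNIV. a i j * (x t $ i - x t $ j)) - \<gamma>2 * (y t $ i)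
                       - \<gamma>3 * (\<delta>h t $ i) + d $ i)) (at t within {0..}) \<and>
             (\<delta>h has_vector_derivative
                (\<chi> i. \<gamma>1 * (\<Sum>j\<in>UNIV. a i j * (x t $ i - x t $ j)) + \<gamma>4 * (y t $ i)))
                (at t within {0..}))
          \<longrightarrow>
          (let \<delta>t = (\<lambda>t. \<delta>h t - (1 / \<gamma>3) *\<^sub>R d);
               ex = (\<lambda>t. cons_err v (x t));
               ey = (\<lambda>t. cons_err v (y t));
               ed = (\<lambda>t. cons_err v (\<delta>t t))
           in (ex \<longlongrightarrow> 0) at_top \<and> (ey \<longlongrightarrow> 0) at_top \<and> (ed \<longlongrightarrow> 0) at_top \<and>
              (\<forall>t1 t2. 0 \<le> t1 \<and> t1 \<le> t2 \<longrightarrow>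
                 H_s \<rho> \<epsilon> \<mu> P (ex t2) (ey t2) + H_d b (ey t2) (ed t2)
                 \<le> H_s \<rho> \<epsilon> \<mu> P (ex t1) (ey t1) + H_d b (ey t1) (ed t1)))))"
proof -
  obtain P c where "transpose P = P" "\<And>z. 1/2 * (z \<bullet> z) \<le> z \<bullet> (P *v z)" "0 < c"
    "\<And>z. v \<bullet> z = 0 \<Longrightarrow> c * (z \<bullet> z) \<le> z \<bullet> (P *v (laplacian a *v z))"
    by (rule laplacian_lyapunov_matrix[OF a_diag a_nonneg tree v_left v_norm]) (rule that)
  then obtain e G
    where lyap: "error_lyapunov (laplacian a) P v (onorm ((*v) P)) (onorm ((*v) (laplacian a))) c e G"
    using error_lyapunov_exists by blast
  interpret error_lyapunov "laplacian a" P v "onorm ((*v) P)" "onorm ((*v) (laplacian a))" c e G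
    by (fact lyap)
  have gains: "0 < G" "0 < e * G" using G_ge e_pos by simp_all
  note converges = consensus_controller_converges[OF lyap a_diag v_left v_norm refl refl refl refl]
  show ?thesis
    apply (rule exI[of _ 1], rule exI[of _ G], rule exI[of _ 1], rule exI[of _ G], intro conjI)
        apply (rule zero_less_one gains)+
    apply (rule exI[of _ "e * G"], rule exI[of _ e], rule exI[of _ 1], rule exI[of _ 1], rule exI[of _ P])
    by (intro conjI allI impI)
      (rule zero_less_one gains e_pos sym_pos_def_P gain_condition lyap_pos converges | assumption)+
qed

end
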